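(* Every Helly CA graph is a uniform CA graph, and there exists a uniform CA graph that is not a Helly CA graph. (Both graph classes taken under the standing assumption.)
   Context: Graphs are finite, undirected, without self-loops; standing assumption: twin-free (no distinct $u,v$ with $N[u]=N[v]$) and no universal vertex, where $N[v]$ is the closed neighbourhood. An arc is a connected proper subset of the circle. A CA representation of $G$ is a bijection $\rho$ from $V(G)$ to a set of arcs (pairwise distinct endpoints) with $u\neq v$ adjacent iff $\rho(u)\cap\rho(v)\neq\emptyset$; $G$ is a CA graph if it has one. A CA graph is Helly (HCA) if it has a CA representation $\rho$ such that for every inclusion-maximal clique $C$ of $G$, $\bigcap_{v\in C}\rho(v)\neq\emptyset$. Intersection types of distinct arcs $A,B$: $\mathtt{di}$ disjoint; $\mathtt{cd}$ $A\subsetneq B$; $\mathtt{cs}$ $B\subsetneq A$; $\mathtt{cc}$ $A\cup B$ is the whole circle and neither contains the other; $\mathtt{ov}$ $A\cap B,A\setminus B,B\setminus A$ nonempty and $A\cup B$ not the whole circle. Sets $A,B$ overlap ($A\between B$) if $A\cap B,A\setminus B,B\setminus A\neq\emptyset$. Neighborhood matrix $\lambda_G$, for $u\neq v$ the first applicable value: $\mathtt{di}$ if nonadjacent; $\mathtt{cd}$ if $N[u]\subsetneq N[v]$; $\mathtt{cs}$ if $N[v]\subsetneq N[u]$; $\mathtt{cc}$ if $N[u]\between N[v]$, $N[u]\cup N[v]=V(G)$, all $w\in N[u]\setminus N[v]$ satisfy $N[w]\subset N[u]$ and all $w\in N[v]\setminus N[u]$ satisfy $N[w]\subset N[v]$;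 $\mathtt{ov}$ otherwise; $u\,\alpha\,v$ means $(\lambda_G)_{u,v}=\alpha$. $\mathcal{N}(G)$: CA representations $\rho$ with intersection type of $\rho(u),\rho(v)$ equal to $(\lambda_G)_{u,v}$ for all $u\neq v$; $\rho[V']=\{\rho(v)\mid v\in V'\}$. An $\mathtt{ov}$-triangle is a set of three vertices pairwise in relation $\mathtt{ov}$; three pairwise intersecting arcs form a non-Helly triangle if their common intersection is empty. $N_T(x)$ for $x\in T$: vertices outside $T$ adjacent to $x$ and to no other vertex of $T$. $\Delta_G$: $\mathtt{ov}$-triangles $T$ with $\bigcup_{v\in T}N[v]=V(G)$ and $v\,\mathtt{cd}\,x$ for all $x\in T$, $v\in N_T(x)$. A CA graph $G$ is uniform if for all $\mathtt{ov}$-triangles $T$ and all $\rho\in\mathcal{N}(G)$, $T\in\Delta_G$ implies $\rho[T]$ is a non-Helly triangle. *)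

theory Defs
  imports "HOL-Analysis.Analysis" "Graph_Theory.Pair_Digraph"
begin

section \<open>Graphs\<close>

text \<open>
  A finite undirected graph without self-loops is a \<^locale>\<open>pair_graph\<close>: its edge relation
  \<^const>\<open>parcs\<close> is symmetric and irreflexive, and contains both orientations of every edge.
\<close>

definition closed_nbhd :: "'a pair_pre_digraph \<Rightarrow> 'a \<Rightarrow> 'a set" where
  "closed_nbhd G v = insert v {u. (v, u) \<in> parcs G}"

definition twin_free :: "'a pair_pre_digraph \<Rightarrow> bool" where
  "twin_free G \<longleftrightarrow>
     \<not> (\<exists>u \<in> pverts G. \<exists>v \<in> pverts G. u \<noteq> v \<and> closed_nbhd G u = closed_nbhd G v)"

definition has_universal_vertex :: "'a pair_pre_digraph \<Rightarrow> bool" where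
  "has_universal_vertex G \<longleftrightarrow> (\<exists>v \<in> pverts G. closed_nbhd G v = pverts G)"

definition clique :: "'a pair_pre_digraph \<Rightarrow> 'a set \<Rightarrow> bool" where
  "clique G C \<longleftrightarrow> C \<subseteq> pverts G \<and> (\<forall>u \<in> C. \<forall>v \<in> C. u \<noteq> v \<longrightarrow> (u, v) \<in> parcs G)"

definition maximal_clique :: "'a pair_pre_digraph \<Rightarrow> 'a set \<Rightarrow> bool" where
  "maximal_clique G C \<longleftrightarrow> clique G C \<and> \<not> (\<exists>D. clique G D \<and> C \<subset> D)"


section \<open>Arcs and circular-arc representations\<close>

abbreviation circle :: "complex set" where
  "circle \<equiv> sphere 0 1"

definition circle_arc :: "complex set \<Rightarrow> bool" where
  "circle_arc A \<longleftrightarrow> connected A \<and> A \<subset> circle"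

text \<open>
  The endpoints of an arc are its boundary points relative to the circle; a connected subset of
  the circle has at most two of them. Boundary points relative to the complex plane would be
  wrong, since an arc has empty interior there.
\<close>

definition arc_endpoints :: "complex set \<Rightarrow> complex set" where
  "arc_endpoints A = (top_of_set circle) frontier_of A"

text \<open>
  All \<open>2 * card (pverts G)\<close> endpoints are pairwise distinct: each arc has two of its own, and no
  two arcs share one. In particular empty and one-point arcs do not occur, and whether an arc
  contains its endpoints does not matter.
\<close>

definition ca_representation :: "'a pair_pre_digraph \<Rightarrow> ('a \<Rightarrow> complex set) \<Rightarrow> bool" where
  "ca_representation G \<rho> \<longleftrightarrow>
     inj_on \<rho> (pverts G) \<and>
     (\<forall>v \<in> pverts G. circle_arc (\<rho> v) \<and> card (arc_endpoints (\<rho> v)) = 2) \<and>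
     (\<forall>u \<in> pverts G. \<forall>v \<in> pverts G. u \<noteq> v \<longrightarrow>
        arc_endpoints (\<rho> u) \<inter> arc_endpoints (\<rho> v) = {}) \<and>
     (\<forall>u \<in> pverts G. \<forall>v \<in> pverts G. u \<noteq> v \<longrightarrow>
        ((u, v) \<in> parcs G \<longleftrightarrow> \<rho> u \<inter> \<rho> v \<noteq> {}))"

definition ca_graph :: "'a pair_pre_digraph \<Rightarrow> bool" where
  "ca_graph G \<longleftrightarrow> pair_graph G \<and> (\<exists>\<rho>. ca_representation G \<rho>)"

definition helly_ca_graph :: "'a pair_pre_digraph \<Rightarrow> bool" where
  "helly_ca_graph G \<longleftrightarrow>
     ca_graph G \<and>
     (\<exists>\<rho>. ca_representation G \<rho> \<and> (\<forall>C. maximal_clique G C \<longrightarrow> (\<Inter>v\<in>C. \<rho> v) \<noteq> {}))"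


section \<open>Intersection types and the neighborhood matrix\<close>

datatype itype = di | cd | cs | cc | ov

definition sets_overlap :: "'b set \<Rightarrow> 'b set \<Rightarrow> bool" where
  "sets_overlap A B \<longleftrightarrow> A \<inter> B \<noteq> {} \<and> A - B \<noteq> {} \<and> B - A \<noteq> {}"

fun has_intersection_type :: "complex set \<Rightarrow> complex set \<Rightarrow> itype \<Rightarrow> bool" where
  "has_intersection_type A B di \<longleftrightarrow> A \<inter> B = {}"
| "has_intersection_type A B cd \<longleftrightarrow> A \<subset> B"
| "has_intersection_type A B cs \<longleftrightarrow> B \<subset> A"
| "has_intersection_type A B cc \<longleftrightarrow> A \<union> B = circle \<and> \<not> A \<subseteq> B \<and> \<not> B \<subseteq> A"
| "has_intersection_type A B ov \<longleftrightarrow> sets_overlap A B \<and> A \<union> B \<noteq> circle"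

text \<open>Only the values at distinct vertices of \<open>G\<close> are meaningful.\<close>

definition nbhd_matrix :: "'a pair_pre_digraph \<Rightarrow> 'a \<Rightarrow> 'a \<Rightarrow> itype" where
  "nbhd_matrix G u v =
     (let N = closed_nbhd G in
      if (u, v) \<notin> parcs G then di
      else if N u \<subset> N v then cd
      else if N v \<subset> N u then cs
      else if sets_overlap (N u) (N v) \<and> N u \<union> N v = pverts G \<and>
              (\<forall>w \<in> N u - N v. N w \<subseteq> N u) \<and> (\<forall>w \<in> N v - N u. N w \<subseteq> N v) then cc
      else ov)"

definition normalized_representations ::
    "'a pair_pre_digraph \<Rightarrow> ('a \<Rightarrow> complex set) set" where
  "normalized_representations G =
     {\<rho>. ca_representation G \<rho> \<and>
         (\<forall>u \<in> pverts G. \<forall>v \<in> pverts G. u \<noteq> v \<longrightarrow>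
            has_intersection_type (\<rho> u) (\<rho> v) (nbhd_matrix G u v))}"


section \<open>Uniform circular-arc graphs\<close>

definition ov_triangle :: "'a pair_pre_digraph \<Rightarrow> 'a set \<Rightarrow> bool" where
  "ov_triangle G T \<longleftrightarrow>
     T \<subseteq> pverts G \<and> card T = 3 \<and>
     (\<forall>u \<in> T. \<forall>v \<in> T. u \<noteq> v \<longrightarrow> nbhd_matrix G u v = ov)"

definition non_helly_triangle :: "complex set set \<Rightarrow> bool" where
  "non_helly_triangle R \<longleftrightarrow>
     card R = 3 \<and> (\<forall>A \<in> R. circle_arc A) \<and>
     (\<forall>A \<in> R. \<forall>B \<in> R. A \<inter> B \<noteq> {}) \<and> \<Inter>R = {}"

definition private_nbhd :: "'a pair_pre_digraph \<Rightarrow> 'a set \<Rightarrow> 'a \<Rightarrow> 'a set" where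
  "private_nbhd G T x =
     {v \<in> pverts G - T. (v, x) \<in> parcs G \<and> (\<forall>y \<in> T - {x}. (v, y) \<notin> parcs G)}"

definition Delta :: "'a pair_pre_digraph \<Rightarrow> 'a set set" where
  "Delta G =
     {T. ov_triangle G T \<and> (\<Union>v\<in>T. closed_nbhd G v) = pverts G \<and>
         (\<forall>x \<in> T. \<forall>v \<in> private_nbhd G T x. nbhd_matrix G v x = cd)}"

definition uniform_ca_graph :: "'a pair_pre_digraph \<Rightarrow> bool" where
  "uniform_ca_graph G \<longleftrightarrow>
     ca_graph G \<and>
     (\<forall>T \<rho>. ov_triangle G T \<longrightarrow> \<rho> \<in> normalized_representations G \<longrightarrow>
        T \<in> Delta G \<longrightarrow> non_helly_triangle (\<rho> ` T))"

end

(*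
  A Helly CA graph G has empty Delta_G, so uniformity is vacuous for it. If T = {a, b, c} were in
  Delta_G, the three arcs would share a point in a Helly representation, so one of them, say that
  of b, lies in the union of the other two, and N[a] and N[c] cover V(G). Since a ov c, some w in
  N[a] - N[c] has a neighbour u outside N[a] (or symmetrically), and membership of T in Delta_G
  forces both w and u to be adjacent to b. A common point of the clique {b, w, u} lies in the arc
  of a or of c, although u is not adjacent to a and w is not adjacent to c.

  The net, a triangle with a pendant vertex at each corner, is uniform but not Helly: in every
  representation, a common point of the triangle would put one of its arcs inside the union of
  the other two, and the pendant neighbour of that arc would then meet another one.
*)

theory Submission
  imports Defs
begin

section \<open>Three arcs with a common point\<close>

text \<open>Twice the signed area of the triangle \<open>y\<close>, \<open>z\<close>,
  \<open>x\<close>; the sign tells on which side of the line from \<open>y\<close> to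
  \<open>z\<close> the point \<open>x\<close> lies.\<close>

definition orient :: "complex \<Rightarrow> complex \<Rightarrow> complex \<Rightarrow> real" where
  "orient y z x = (Re z - Re y) * (Im x - Im y) - (Im z - Im y) * (Re x - Re y)"

lemma orient_cyclic: "orient y z x = orient x y z"
  by (simp add: orient_def algebra_simps)

lemma continuous_on_orient: "continuous_on S (orient y z)"
  unfolding orient_def by (intro continuous_intros)

lemma mem_circle_iff: "z \<in> circle \<longleftrightarrow> Re z * Re z + Im z * Im z = 1"
  by (simp add: cmod_def power2_eq_square)

text \<open>A line meets the circle at most twice: substituting \<open>x = y + t (z - y)\<close>
  into the circle equation leaves \<open>t (t - 1) = 0\<close>.\<close>

lemma orient_eq_0_on_circle:
  assumes "x \<in> circle" "y \<in> circle" "z \<in> circle" "y \<noteq> z" "orient y z x = 0"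
  shows "x = y \<or> x = z"
proof -
  define d1 d2 where "d1 = Re z - Re y" and "d2 = Im z - Im y"
  define q where "q = d1 * d1 + d2 * d2"
  have "d1 \<noteq> 0 \<or> d2 \<noteq> 0"
    using assms(4) by (auto simp: d1_def d2_def complex_eq_iff)
  then have q: "q \<noteq> 0"
    by (simp add: q_def sum_squares_eq_zero_iff)
  \<comment> \<open>The projection coefficient of \<open>x - y\<close> on \<open>z - y\<close>;
    collinearity makes the projection equal to \<open>x - y\<close>.\<close>
  define t where "t = (d1 * (Re x - Re y) + d2 * (Im x - Im y)) / q"
  have o: "d1 * (Im x - Im y) = d2 * (Re x - Re y)"
    using assms(5) by (simp add: orient_def d1_def d2_def)
  have tq: "t * q = d1 * (Re x - Re y) + d2 * (Im x - Im y)"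
    using q by (simp add: t_def)
  have "(t * d1) * q = (Re x - Re y) * q"
    using tq o unfolding q_def by algebra
  then have re: "Re x = Re y + t * d1" using q by simp
  have "(t * d2) * q = (Im x - Im y) * q"
    using tq o unfolding q_def by algebra
  then have im: "Im x = Im y + t * d2" using q by simp
  have "Re z = Re y + d1" "Im z = Im y + d2" by (auto simp: d1_def d2_def)
  with assms(1-3) re im have "t * (t - 1) * q = 0"
    unfolding mem_circle_iff q_def by algebra
  then have "t = 0 \<or> t = 1" using q by simp
  then show ?thesis
    using re im by (auto simp: complex_eq_iff d1_def d2_def)
qed

text \<open>On \<open>S\<close> the continuous function \<open>orient y z\<close> has no zero, since
  its zeros on the circle are \<open>y\<close> and \<open>z\<close>; connectedness then fixes its
  sign.\<close>

lemma orient_same_sign: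
  assumes "connected S" "S \<subseteq> circle" "p \<in> S" "x \<in> S"
    and "y \<in> circle - S" "z \<in> circle - S" "y \<noteq> z"
  shows "orient y z p * orient y z x > 0"
proof -
  have nz: "orient y z w \<noteq> 0" if "w \<in> S" for w
    using orient_eq_0_on_circle[of w y z] that assms by blast
  have conn: "connected (orient y z ` S)"
    using assms(1) continuous_on_orient by (rule connected_continuous_image[rotated])
  have "\<not> (orient y z u < 0 \<and> 0 < orient y z v)" if "u \<in> S" "v \<in> S" for u v
    using connectedD_interval[OF conn, of "orient y z u" "orient y z v" 0] that nz by force
  then show ?thesis
    using nz assms(3,4) by (metis linorder_neqE_linordered_idom mult_neg_neg mult_pos_pos)
qed

lemma inner_less_1_on_circle:
  assumes "x \<in> circle" "y \<in> circle" "x \<noteq> y"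
  shows "Re x * Re y + Im x * Im y < 1"
proof -
  have "(Re x - Re y)^2 + (Im x - Im y)^2 > 0"
    using assms(3) by (simp add: sum_power2_gt_zero_iff complex_eq_iff)
  then show ?thesis
    using assms(1,2) unfolding mem_circle_iff by (simp add: power2_eq_square algebra_simps)
qed

text \<open>
  If \<open>x\<close>, \<open>y\<close>, \<open>z\<close> witnessed the contrary, then \<open>p\<close> would lie on the same side of each side of the
  triangle \<open>xyz\<close> as the opposite vertex, hence inside this inscribed triangle, contradicting
  \<open>p \<in> circle\<close>.
\<close>

lemma three_connected_on_circle:
  assumes "connected A" "connected B" "connected C"
    and "A \<subseteq> circle" "B \<subseteq> circle" "C \<subseteq> circle"
    and "p \<in> A" "p \<in> B" "p \<in> C"
  shows "A \<subseteq> B \<union> C \<or> B \<subseteq> A \<union> C \<or> C \<subseteq> A \<union> B"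
proof (rule ccontr)
  assume "\<not> ?thesis"
  then obtain x y z where x: "x \<in> A" "x \<notin> B" "x \<notin> C" and y: "y \<in> B" "y \<notin> A" "y \<notin> C"
    and z: "z \<in> C" "z \<notin> A" "z \<notin> B"
    by blast
  have ne: "x \<noteq> y" "y \<noteq> z" "z \<noteq> x" using x y z by auto
  have circ: "x \<in> circle" "y \<in> circle" "z \<in> circle" "p \<in> circle"
    using x y z assms by auto
  \<comment> \<open>Unnormalised barycentric coordinates of \<open>p\<close> in the triangle
    \<open>x\<close>, \<open>y\<close>, \<open>z\<close>, with sum \<open>s\<close>.\<close>
  define a b c s where "a = orient y z p" "b = orient z x p" "c = orient x y p" "s = orient x y z"
  note d = a_b_c_s_def
  have "a * s > 0"
    using orient_same_sign[of A p x y z] assms x y z ne circ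
    by (simp add: d orient_cyclic[of y z x])
  moreover have "b * s > 0"
    using orient_same_sign[of B p y z x] assms x y z ne circ
    by (simp add: d orient_cyclic[of z x y] orient_cyclic[of y z x])
  moreover have "c * s > 0"
    using orient_same_sign[of C p z x y] assms x y z ne circ by (simp add: d)
  ultimately have pos: "a * b > 0" "b * c > 0" "c * a > 0"
    by (auto simp: zero_less_mult_iff)
  have s: "s = a + b + c"
    by (simp add: d orient_def algebra_simps)
  have re: "s * Re p = a * Re x + b * Re y + c * Re z"
    by (simp add: d orient_def algebra_simps)
  have im: "s * Im p = a * Im x + b * Im y + c * Im z"
    by (simp add: d orient_def algebra_simps)
  \<comment> \<open>Expanding the squared length of \<open>s p = a x + b y + c z\<close> for unit
    vectors gives this identity, whose three summands are all positive.\<close>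
  have "a * b * (1 - (Re x * Re y + Im x * Im y)) + b * c * (1 - (Re y * Re z + Im y * Im z))
      + c * a * (1 - (Re z * Re x + Im z * Im x)) = 0"
  proof -
    have "(s * Re p)^2 + (s * Im p)^2 = s^2 * (Re p * Re p + Im p * Im p)"
      by (simp add: power2_eq_square algebra_simps)
    also have "\<dots> = (a + b + c)^2"
      using circ(4) unfolding mem_circle_iff by (simp add: s)
    finally have "(a * Re x + b * Re y + c * Re z)^2 + (a * Im x + b * Im y + c * Im z)^2
        = (a + b + c)^2"
      by (simp add: re im)
    moreover have "(a * Re x + b * Re y + c * Re z)^2 + (a * Im x + b * Im y + c * Im z)^2
      = a * a * (Re x * Re x + Im x * Im x) + b * b * (Re y * Re y + Im y * Im y)
        + c * c * (Re z * Re z + Im z * Im z)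
        + 2 * (a * b * (Re x * Re y + Im x * Im y) + b * c * (Re y * Re z + Im y * Im z)
        + c * a * (Re z * Re x + Im z * Im x))"
      by (simp add: power2_eq_square algebra_simps)
    ultimately show ?thesis
      using circ(1-3) unfolding mem_circle_iff by algebra
  qed
  moreover have "a * b * (1 - (Re x * Re y + Im x * Im y)) > 0"
    "b * c * (1 - (Re y * Re z + Im y * Im z)) > 0"
    "c * a * (1 - (Re z * Re x + Im z * Im x)) > 0"
    using pos inner_less_1_on_circle circ ne by auto
  ultimately show False by linarith
qed

section \<open>Helly circular-arc graphs\<close>

lemma pair_graph_adj_sym:
  assumes "pair_graph G" "(u, v) \<in> parcs G"
  shows "(v, u) \<in> parcs G"
proof -
  interpret pair_graph G by fact
  show ?thesis using assms(2) pair_sym_arcs by (auto simp: symmetric_def dest: symD)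
qed

lemma pair_graph_adj_verts:
  assumes "pair_graph G" "(u, v) \<in> parcs G"
  shows "u \<in> pverts G" "v \<in> pverts G" "u \<noteq> v"
proof -
  interpret pair_graph G by fact
  show "u \<in> pverts G" "v \<in> pverts G" "u \<noteq> v"
    using assms(2) in_arcsD1 in_arcsD2 pair_no_loops by fastforce+
qed

lemma clique_extends_to_maximal:
  assumes "finite (pverts G)" "clique G K"
  obtains C where "maximal_clique G C" "K \<subseteq> C"
proof -
  have "{C. clique G C} \<subseteq> Pow (pverts G)"
    by (auto simp: clique_def)
  then have "finite {C. clique G C}"
    using assms(1) finite_subset by blast
  from finite_has_maximal2[OF this, of K] assms(2)
  obtain C where "clique G C" "K \<subseteq> C" "\<forall>D. clique G D \<longrightarrow> C \<subseteq> D \<longrightarrow> C = D"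
    by auto
  then show ?thesis
    by (intro that[of C]) (auto simp: maximal_clique_def)
qed

text \<open>The Helly property speaks of maximal cliques; a triangle inherits it from a maximal
  clique containing it.\<close>

lemma triangle_common_point:
  assumes G: "pair_graph G"
    and helly: "\<forall>C. maximal_clique G C \<longrightarrow> (\<Inter>v\<in>C. \<rho> v) \<noteq> {}"
    and adj: "(u, v) \<in> parcs G" "(v, w) \<in> parcs G" "(u, w) \<in> parcs G"
  obtains p where "p \<in> \<rho> u" "p \<in> \<rho> v" "p \<in> \<rho> w"
proof -
  interpret pair_graph G by fact
  have "clique G {u, v, w}"
    using adj pair_graph_adj_sym[OF G] pair_graph_adj_verts[OF G] by (auto simp: clique_def)
  then obtain C where "maximal_clique G C" "{u, v, w} \<subseteq> C"
    using clique_extends_to_maximal[OF pair_finite_verts] by metis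
  then show ?thesis
    using helly that by fastforce
qed

lemma ca_representation_arc:
  assumes "ca_representation G \<rho>" "v \<in> pverts G"
  shows "circle_arc (\<rho> v)"
  using assms by (simp add: ca_representation_def)

lemma ca_representation_adj:
  assumes "ca_representation G \<rho>" "u \<in> pverts G" "v \<in> pverts G" "u \<noteq> v"
  shows "(u, v) \<in> parcs G \<longleftrightarrow> \<rho> u \<inter> \<rho> v \<noteq> {}"
  using assms by (simp add: ca_representation_def)

lemma nbhd_matrix_ov_adj: "nbhd_matrix G u v = ov \<Longrightarrow> (u, v) \<in> parcs G"
  by (simp add: nbhd_matrix_def Let_def split: if_splits)

text \<open>Twin-freeness and the covering hypothesis give all the other clauses of
  \<open>cc\<close>, so the entry \<open>ov\<close> can only arise from a failing containment
  clause.\<close>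

lemma nbhd_matrix_ovD:
  assumes "pair_graph G" "twin_free G" "nbhd_matrix G u v = ov"
    and "closed_nbhd G u \<union> closed_nbhd G v = pverts G"
  shows "(\<exists>w \<in> closed_nbhd G u - closed_nbhd G v. \<not> closed_nbhd G w \<subseteq> closed_nbhd G u) \<or>
         (\<exists>w \<in> closed_nbhd G v - closed_nbhd G u. \<not> closed_nbhd G w \<subseteq> closed_nbhd G v)"
proof -
  have adj: "(u, v) \<in> parcs G"
    using assms(3) by (rule nbhd_matrix_ov_adj)
  note v = pair_graph_adj_verts[OF assms(1) adj]
  have "closed_nbhd G u \<noteq> closed_nbhd G v"
    using v assms(2) by (auto simp: twin_free_def)
  moreover have "u \<in> closed_nbhd G u \<inter> closed_nbhd G v"
    using pair_graph_adj_sym[OF assms(1) adj] by (auto simp: closed_nbhd_def)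
  ultimately show ?thesis
    using assms(3,4) adj
    by (auto simp: nbhd_matrix_def Let_def sets_overlap_def split: if_splits)
qed

section \<open>Emptiness of \<open>Delta G\<close> for Helly graphs\<close>

text \<open>The case in which the failing containment is on the side of \<open>a\<close>; exchanging
  \<open>a\<close> and \<open>c\<close> gives the other case.\<close>

lemma helly_middle_arc_contradiction:
  assumes G: "pair_graph G"
    and rep: "ca_representation G \<rho>"
    and helly: "\<forall>C. maximal_clique G C \<longrightarrow> (\<Inter>v\<in>C. \<rho> v) \<noteq> {}"
    and T: "{a, b, c} \<in> Delta G" "a \<noteq> b" "b \<noteq> c" "a \<noteq> c"
    and adj: "(a, b) \<in> parcs G" "(b, c) \<in> parcs G" "(a, c) \<in> parcs G"
    and sub: "\<rho> b \<subseteq> \<rho> a \<union> \<rho> c"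
    and cover: "closed_nbhd G a \<union> closed_nbhd G c = pverts G"
    and w: "w \<in> closed_nbhd G a - closed_nbhd G c" "\<not> closed_nbhd G w \<subseteq> closed_nbhd G a"
  shows False
proof -
  note sym = pair_graph_adj_sym[OF G] and vs = pair_graph_adj_verts[OF G]
  have priv: "closed_nbhd G v \<subset> closed_nbhd G x"
    if "x \<in> {a, b, c}" "v \<in> private_nbhd G {a, b, c} x" for x v
  proof -
    have "nbhd_matrix G v x = cd"
      using T(1) that unfolding Delta_def by blast
    then show ?thesis
      by (auto simp: nbhd_matrix_def Let_def split: if_splits)
  qed
  have wa: "(a, w) \<in> parcs G" and wc: "(c, w) \<notin> parcs G" "w \<noteq> c"
    using w(1) adj sym by (auto simp: closed_nbhd_def)
  have wb: "(b, w) \<in> parcs G"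
  proof (rule ccontr)
    assume "(b, w) \<notin> parcs G"
    \<comment> \<open>As a private neighbour of \<open>a\<close>, \<open>w\<close> would have its
      closed neighbourhood inside that of \<open>a\<close>, against its choice.\<close>
    then have "w \<in> private_nbhd G {a, b, c} a"
      using wa wc sym vs[OF wa] adj by (auto simp: private_nbhd_def)
    then show False using priv w(2) by blast
  qed
  obtain u where u: "u \<in> closed_nbhd G w" "u \<notin> closed_nbhd G a"
    using w(2) by blast
  have uw: "(w, u) \<in> parcs G" and ua: "(a, u) \<notin> parcs G" "u \<noteq> a"
    using u wa by (auto simp: closed_nbhd_def)
  have "u \<in> closed_nbhd G c"
    using u cover vs(2)[OF uw] by blast
  then have uc: "(c, u) \<in> parcs G"
    using ua adj(3) by (auto simp: closed_nbhd_def)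
  have ub: "(b, u) \<in> parcs G"
  proof (rule ccontr)
    assume "(b, u) \<notin> parcs G"
    \<comment> \<open>As a private neighbour of \<open>c\<close>, \<open>u\<close> would force its
      neighbour \<open>w\<close> into the closed neighbourhood of \<open>c\<close>.\<close>
    then have "u \<in> private_nbhd G {a, b, c} c"
      using uc ua sym vs[OF uc] adj by (auto simp: private_nbhd_def)
    then have "closed_nbhd G u \<subset> closed_nbhd G c" using priv by blast
    moreover have "w \<in> closed_nbhd G u" using sym[OF uw] by (simp add: closed_nbhd_def)
    ultimately show False using w(1) by blast
  qed
  obtain q where q: "q \<in> \<rho> b" "q \<in> \<rho> w" "q \<in> \<rho> u"
    using triangle_common_point[OF G helly wb uw ub] by blast
  have "\<rho> a \<inter> \<rho> u = {}"
    using ca_representation_adj[OF rep, of a u] ua vs[OF wa] vs[OF uw] by blast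
  moreover have "\<rho> c \<inter> \<rho> w = {}"
    using ca_representation_adj[OF rep, of c w] wc vs[OF uc] vs[OF uw] by blast
  ultimately show False using q sub by blast
qed

text \<open>Otherwise every arc meeting \<open>\<rho> b\<close> meets \<open>\<rho> a\<close> or
  \<open>\<rho> c\<close>, so the neighbourhoods of \<open>a\<close> and \<open>c\<close> alone
  cover the graph and \<open>nbhd_matrix_ovD\<close> applies to this pair.\<close>

lemma helly_middle_arc:
  assumes G: "pair_graph G" "twin_free G"
    and rep: "ca_representation G \<rho>"
    and helly: "\<forall>C. maximal_clique G C \<longrightarrow> (\<Inter>v\<in>C. \<rho> v) \<noteq> {}"
    and T: "{a, b, c} \<in> Delta G" "a \<noteq> b" "b \<noteq> c" "a \<noteq> c"
  shows "\<not> \<rho> b \<subseteq> \<rho> a \<union> \<rho> c"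
proof
  assume sub: "\<rho> b \<subseteq> \<rho> a \<union> \<rho> c"
  note sym = pair_graph_adj_sym[OF G(1)] and vs = pair_graph_adj_verts[OF G(1)]
  have ovs: "nbhd_matrix G a b = ov" "nbhd_matrix G b c = ov" "nbhd_matrix G a c = ov"
    using T unfolding Delta_def ov_triangle_def by auto
  then have adj: "(a, b) \<in> parcs G" "(b, c) \<in> parcs G" "(a, c) \<in> parcs G"
    by (auto intro: nbhd_matrix_ov_adj)
  note abc = vs[OF adj(1)] vs[OF adj(2)]
  have "closed_nbhd G b \<subseteq> closed_nbhd G a \<union> closed_nbhd G c"
  proof
    fix v assume "v \<in> closed_nbhd G b"
    then consider "v = b" | "(b, v) \<in> parcs G" by (auto simp: closed_nbhd_def)
    then show "v \<in> closed_nbhd G a \<union> closed_nbhd G c"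
    proof cases
      case 1 then show ?thesis using adj by (auto simp: closed_nbhd_def)
    next
      case 2
      then have v: "v \<in> pverts G" and "\<rho> b \<inter> \<rho> v \<noteq> {}"
        using vs[OF 2] ca_representation_adj[OF rep, of b v] by auto
      then have "\<rho> a \<inter> \<rho> v \<noteq> {} \<or> \<rho> c \<inter> \<rho> v \<noteq> {}" using sub by blast
      then show ?thesis
        using ca_representation_adj[OF rep, of a v] ca_representation_adj[OF rep, of c v] abc v
        by (auto simp: closed_nbhd_def)
    qed
  qed
  then have cover: "closed_nbhd G a \<union> closed_nbhd G c = pverts G"
    using T(1) unfolding Delta_def by blast
  have T': "{c, b, a} \<in> Delta G" using T(1) by (simp add: insert_commute)
  from nbhd_matrix_ovD[OF G ovs(3) cover] show False
  proof
    assume "\<exists>w \<in> closed_nbhd G a - closed_nbhd G c. \<not> closed_nbhd G w \<subseteq> closed_nbhd G a"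
    then show False
      using helly_middle_arc_contradiction[OF G(1) rep helly T adj sub cover] by blast
  next
    assume "\<exists>w \<in> closed_nbhd G c - closed_nbhd G a. \<not> closed_nbhd G w \<subseteq> closed_nbhd G c"
    then show False
      using helly_middle_arc_contradiction[OF G(1) rep helly T'] T(2-4) adj[THEN sym] sub cover
      by (metis Un_commute)
  qed
qed

text \<open>A common point of the three arcs puts one of them inside the union of the other two;
  \<open>helly_middle_arc\<close> rules this out for each choice of the middle vertex.\<close>

lemma helly_Delta_empty:
  assumes G: "pair_graph G" "twin_free G" and "helly_ca_graph G"
  shows "Delta G = {}"
proof (rule ccontr)
  assume "Delta G \<noteq> {}"
  then obtain T where T: "T \<in> Delta G" by blast
  then obtain a b c where abc: "T = {a, b, c}" "a \<noteq> b" "b \<noteq> c" "a \<noteq> c"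
    by (auto simp: Delta_def ov_triangle_def card_3_iff)
  obtain \<rho> where rep: "ca_representation G \<rho>"
    and helly: "\<forall>C. maximal_clique G C \<longrightarrow> (\<Inter>v\<in>C. \<rho> v) \<noteq> {}"
    using assms(3) by (auto simp: helly_ca_graph_def)
  have ovs: "nbhd_matrix G a b = ov" "nbhd_matrix G b c = ov" "nbhd_matrix G a c = ov"
    using T abc unfolding Delta_def ov_triangle_def by auto
  then have adj: "(a, b) \<in> parcs G" "(b, c) \<in> parcs G" "(a, c) \<in> parcs G"
    by (auto intro: nbhd_matrix_ov_adj)
  obtain p where p: "p \<in> \<rho> a" "p \<in> \<rho> b" "p \<in> \<rho> c"
    using triangle_common_point[OF G(1) helly adj] by blast
  have arcs: "connected (\<rho> v)" "\<rho> v \<subseteq> circle" if "v \<in> {a, b, c}" for v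
    using ca_representation_arc[OF rep, of v] T that abc(1)
    by (auto simp: circle_arc_def Delta_def ov_triangle_def)
  have "\<not> \<rho> b \<subseteq> \<rho> a \<union> \<rho> c"
    using helly_middle_arc[OF G rep helly, of a b c] T abc by simp
  moreover have "\<not> \<rho> a \<subseteq> \<rho> b \<union> \<rho> c"
    using helly_middle_arc[OF G rep helly, of b a c] T abc by (simp add: insert_commute)
  moreover have "\<not> \<rho> c \<subseteq> \<rho> a \<union> \<rho> b"
    using helly_middle_arc[OF G rep helly, of a c b] T abc by (simp add: insert_commute)
  ultimately show False
    using three_connected_on_circle[OF _ _ _ _ _ _ p] arcs by simp
qed

lemma helly_imp_uniform:
  assumes "pair_graph G" "twin_free G" "helly_ca_graph G"
  shows "uniform_ca_graph G"
  using helly_Delta_empty[OF assms] assms(3)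
  by (simp add: uniform_ca_graph_def helly_ca_graph_def)

section \<open>The net\<close>

text \<open>Period 12, because six arcs need twelve distinct endpoints.\<close>

definition clock :: "real \<Rightarrow> complex" where
  "clock x = cis (x * (pi / 6))"

text \<open>Hours are not reduced modulo 12, so an arc running past hour 12 simply has
  \<open>j > 12\<close>.\<close>

definition arc12 :: "int \<Rightarrow> int \<Rightarrow> complex set" where
  "arc12 i j = clock ` {real_of_int i..real_of_int j}"

lemma clock_in_circle [simp]: "cmod (clock x) = 1"
  by (simp add: clock_def)

lemma clock_eq_iff:
  "clock x = clock y \<longleftrightarrow> (\<exists>k::int. x = y + 12 * of_int k)"
proof -
  have "clock x = clock y \<longleftrightarrow>
      (\<exists>k::int. \<i> * complex_of_real (x * (pi / 6)) =
        \<i> * complex_of_real (y * (pi / 6)) + of_int (2 * k) * pi * \<i>)"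
    unfolding clock_def cis_conv_exp exp_eq by simp
  also have "\<dots> \<longleftrightarrow> (\<exists>k::int. x * (pi / 6) = y * (pi / 6) + 2 * k * pi)"
    by (simp add: complex_eq_iff)
  also have "\<dots> \<longleftrightarrow> (\<exists>k::int. x = y + 12 * of_int k)"
  proof -
    have "x * (pi / 6) = y * (pi / 6) + 2 * of_int k * pi \<longleftrightarrow> pi * x = pi * (y + 12 * of_int k)"
      for k :: int
      by (simp add: algebra_simps)
    then show ?thesis by simp
  qed
  finally show ?thesis .
qed

lemma clock_surj:
  assumes "z \<in> circle"
  obtains x where "a \<le> x" "x < a + 12" "z = clock x"
proof -
  have "z \<noteq> 0" using assms by auto
  then have "cis (Arg z) = z" using assms cis_Arg[of z] by (simp add: sgn_eq)
  then have z: "z = clock (Arg z * 6 / pi)" by (simp add: clock_def)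
  define y where "y = Arg z * 6 / pi"
  \<comment> \<open>The number of full turns separating \<open>y\<close> from the window of length
    12 starting at \<open>a\<close>.\<close>
  define k where "k = \<lfloor>(y - a) / 12\<rfloor>"
  have k: "of_int k \<le> (y - a) / 12" "(y - a) / 12 < of_int k + 1"
    unfolding k_def by linarith+
  have "clock (y - 12 * of_int k) = clock y"
    unfolding clock_eq_iff by (intro exI[of _ "- k"]) simp
  then show ?thesis
    using k z by (intro that[of "y - 12 * of_int k"]) (auto simp: y_def field_simps)
qed

text \<open>Every point has exactly one hour in the window from \<open>i\<close> to
  \<open>i + 12\<close>; those beyond \<open>j\<close> form the complement.\<close>

lemma circle_minus_arc12:
  assumes "i < j" "j < i + 12"
  shows "circle - arc12 i j = clock ` {real_of_int j<..<real_of_int i + 12}"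
    (is "?L = ?R")
proof
  show "?L \<subseteq> ?R"
  proof
    fix z assume z: "z \<in> ?L"
    then obtain x where "real_of_int i \<le> x" "x < real_of_int i + 12" "z = clock x"
      using clock_surj[of z "real_of_int i"] by blast
    with z show "z \<in> ?R" by (force simp: arc12_def)
  qed
  show "?R \<subseteq> ?L"
  proof
    fix z assume "z \<in> ?R"
    then obtain x where x: "real_of_int j < x" "x < real_of_int i + 12" "z = clock x"
      by auto
    have "z \<notin> arc12 i j"
    proof
      assume "z \<in> arc12 i j"
      then obtain y k where "real_of_int i \<le> y" "y \<le> real_of_int j" "x = y + 12 * real_of_int k"
        unfolding arc12_def x(3) image_iff clock_eq_iff by auto
      with x have "0 < real_of_int k" "real_of_int k < 1" by linarith+
      then show False by simp
    qed
    then show "z \<in> ?L" using x by simp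
  qed
qed

lemma continuous_on_clock: "continuous_on S clock"
  unfolding clock_def by (intro continuous_intros)

text \<open>The arc is closed, so its frontier is its intersection with the closure of the
  complementary arc from \<open>j\<close> to \<open>i + 12\<close>, and these meet only at the
  ends.\<close>

lemma arc12_endpoints:
  assumes "i < j" "j < i + 12"
  shows "arc_endpoints (arc12 i j) = {clock (of_int i), clock (of_int j)}"
proof -
  let ?U = "{real_of_int j<..<real_of_int i + 12}"
  have arc: "arc12 i j \<subseteq> circle" by (auto simp: arc12_def)
  have "closed (arc12 i j)"
    unfolding arc12_def
    by (intro compact_imp_closed compact_continuous_image continuous_on_clock compact_Icc)
  then have ep: "arc_endpoints (arc12 i j) = arc12 i j \<inter> (circle \<inter> closure (clock ` ?U))"
    using arc unfolding arc_endpoints_def frontier_of_closures closure_of_subtopology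
    by (simp add: circle_minus_arc12[OF assms, symmetric] Int_absorb1)
  have "clock ` {real_of_int j..real_of_int i + 12} \<subseteq> closure (clock ` ?U)"
    using image_closure_subset[OF continuous_on_clock closed_closure closure_subset, of ?U]
      assms by simp
  moreover have "clock (real_of_int i + 12) = clock (real_of_int i)"
    unfolding clock_eq_iff by (intro exI[of _ 1]) simp
  moreover have "real_of_int j \<in> {real_of_int j..real_of_int i + 12}"
    "real_of_int i + 12 \<in> {real_of_int j..real_of_int i + 12}"
    using assms by auto
  ultimately have ends_closure: "clock (real_of_int i) \<in> closure (clock ` ?U)"
    "clock (real_of_int j) \<in> closure (clock ` ?U)"
    by (metis image_subset_iff)+
  have ends_arc: "clock (real_of_int i) \<in> arc12 i j" "clock (real_of_int j) \<in> arc12 i j"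
    using assms by (auto simp: arc12_def)
  have only_ends: "x = of_int i \<or> x = of_int j"
    if x: "clock x \<in> closure (clock ` ?U)" "real_of_int i \<le> x" "x \<le> of_int j" for x
  proof -
    have "closure (clock ` ?U) \<subseteq> clock ` {real_of_int j..real_of_int i + 12}"
      by (intro closure_minimal compact_imp_closed compact_continuous_image
          continuous_on_clock compact_Icc) auto
    then obtain y where y: "real_of_int j \<le> y" "y \<le> real_of_int i + 12" "clock y = clock x"
      using x(1) by fastforce
    then obtain k where k: "y = x + 12 * real_of_int k"
      using clock_eq_iff by blast
    then have "0 \<le> real_of_int k" "real_of_int k \<le> 1" using y x by linarith+
    \<comment> \<open>For \<open>k = 0\<close> the common hour is \<open>j\<close>; for
      \<open>k = 1\<close> it is \<open>i\<close>, read as \<open>i + 12\<close> on the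
      complementary side.\<close>
    then have "k = 0 \<or> k = 1" by linarith
    then show ?thesis using y k x by auto
  qed
  show ?thesis
    unfolding ep
  proof (intro subset_antisym subsetI)
    fix z assume "z \<in> arc12 i j \<inter> (circle \<inter> closure (clock ` ?U))"
    then show "z \<in> {clock (of_int i), clock (of_int j)}"
      using only_ends unfolding arc12_def by fastforce
  next
    fix z assume "z \<in> {clock (of_int i), clock (of_int j)}"
    then show "z \<in> arc12 i j \<inter> (circle \<inter> closure (clock ` ?U))"
      using ends_closure ends_arc arc by blast
  qed
qed

text \<open>Turns distinctness of endpoints into residue arithmetic.\<close>

lemma clock_int_eq_iff:
  "clock (of_int i) = clock (of_int j) \<longleftrightarrow> i mod 12 = j mod 12"
proof -
  have "real_of_int i = real_of_int j + 12 * of_int k \<longleftrightarrow> i = j + 12 * k" for k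
    by linarith
  then show ?thesis
    unfolding clock_eq_iff by (simp add: mod_eq_dvd_iff dvd_def)
      (metis add_diff_cancel_left' diff_add_cancel)
qed

lemma arc12_circle_arc:
  assumes "i < j" "j < i + 12"
  shows "circle_arc (arc12 i j)"
proof -
  have "connected (arc12 i j)"
    unfolding arc12_def
    by (intro connected_continuous_image continuous_on_clock connected_Icc)
  moreover have "circle - arc12 i j \<noteq> {}"
    using assms by (simp add: circle_minus_arc12)
  moreover have "arc12 i j \<subseteq> circle" by (auto simp: arc12_def)
  ultimately show ?thesis by (auto simp: circle_arc_def)
qed

text \<open>The second arc fits into the gap between hour \<open>j\<close> and the return of hour
  \<open>i\<close> at \<open>i + 12\<close>.\<close>

lemma arc12_disjoint:
  assumes "j < k" "l < i + 12"
  shows "arc12 i j \<inter> arc12 k l = {}"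
proof (rule ccontr)
  assume "arc12 i j \<inter> arc12 k l \<noteq> {}"
  then obtain x y m where "real_of_int i \<le> x" "x \<le> of_int j" "real_of_int k \<le> y" "y \<le> of_int l"
    "y = x + 12 * real_of_int m"
    unfolding arc12_def by (auto simp: image_iff) (metis clock_eq_iff)
  with assms have "0 < real_of_int m" "real_of_int m < 1" by linarith+
  then show False by simp
qed

text \<open>Two readings \<open>m\<close> and \<open>n\<close> of the common hour are allowed, for
  arcs that meet across hour 12.\<close>

lemma arc12_inter:
  assumes "i \<le> m" "m \<le> j" "k \<le> n" "n \<le> l" "m mod 12 = n mod 12"
  shows "arc12 i j \<inter> arc12 k l \<noteq> {}"
proof -
  have "clock (of_int m) = clock (of_int n)"
    using assms(5) by (simp only: clock_int_eq_iff)
  then have "clock (of_int m) \<in> arc12 i j \<inter> arc12 k l"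
    using assms(1-4) unfolding arc12_def
    by (metis (mono_tags, lifting) IntI atLeastAtMost_iff imageI of_int_le_iff)
  then show ?thesis by blast
qed

section \<open>The net and an explicit model of it by arcs\<close>

definition net :: "nat pair_pre_digraph" where
  "net = \<lparr>pverts = {0, 1, 2, 3, 4, 5},
          parcs = {(0,1), (1,0), (1,2), (2,1), (0,2), (2,0),
                   (0,3), (3,0), (1,4), (4,1), (2,5), (5,2)}\<rparr>"

text \<open>Corners \<open>0\<close>, \<open>1\<close>, \<open>2\<close> get arcs of length 5
  starting every four hours, which cover the clock. The pendant vertex \<open>i + 3\<close> gets an
  arc of length 1 in the stretch covered by corner \<open>i\<close> only. Modulo 12, each hour is an
  endpoint exactly once.\<close>

definition net_left :: "nat \<Rightarrow> int" where
  "net_left v = [0, 4, 8, 2, 6, 10] ! v"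

definition net_right :: "nat \<Rightarrow> int" where
  "net_right v = [5, 9, 13, 3, 7, 11] ! v"

definition net_arcs :: "nat \<Rightarrow> complex set" where
  "net_arcs v = arc12 (net_left v) (net_right v)"

lemma net_simps:
  "pverts net = {0, 1, 2, 3, 4, 5}"
  "net_left 0 = 0" "net_left 1 = 4" "net_left (Suc 0) = 4" "net_left 2 = 8"
  "net_left 3 = 2" "net_left 4 = 6" "net_left 5 = 10"
  "net_right 0 = 5" "net_right 1 = 9" "net_right (Suc 0) = 9" "net_right 2 = 13"
  "net_right 3 = 3" "net_right 4 = 7" "net_right 5 = 11"
  by (simp_all add: net_def net_left_def net_right_def)

lemma closed_nbhd_net:
  "closed_nbhd net 0 = {0, 1, 2, 3}" "closed_nbhd net 1 = {0, 1, 2, 4}"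
  "closed_nbhd net (Suc 0) = {0, 1, 2, 4}"
  "closed_nbhd net 2 = {0, 1, 2, 5}" "closed_nbhd net 3 = {0, 3}"
  "closed_nbhd net 4 = {1, 4}" "closed_nbhd net 5 = {2, 5}"
  by (auto simp: closed_nbhd_def net_def)

lemma pair_graph_net: "pair_graph net"
  by unfold_locales (auto simp: net_def symmetric_def sym_def)

lemma twin_free_net: "twin_free net"
  by (simp add: twin_free_def net_simps closed_nbhd_net set_eq_subset)

lemma no_universal_net: "\<not> has_universal_vertex net"
  by (simp add: has_universal_vertex_def net_simps closed_nbhd_net set_eq_subset)

lemma net_adjacent_iff:
  assumes "u \<in> pverts net" "v \<in> pverts net" "u < v"
  shows "(u, v) \<in> parcs net \<longleftrightarrow> net_arcs u \<inter> net_arcs v \<noteq> {}"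
proof -
  have "net_arcs 0 \<inter> net_arcs 1 \<noteq> {}" "net_arcs 1 \<inter> net_arcs 2 \<noteq> {}"
    "net_arcs 0 \<inter> net_arcs 2 \<noteq> {}" "net_arcs 0 \<inter> net_arcs 3 \<noteq> {}"
    "net_arcs 1 \<inter> net_arcs 4 \<noteq> {}" "net_arcs 2 \<inter> net_arcs 5 \<noteq> {}"
    \<comment> \<open>The arcs of \<open>0\<close> and \<open>2\<close> meet at hour 0, which is
      hour 12 for the latter.\<close>
    using arc12_inter[of 0 4 5 4 4 9] arc12_inter[of 4 8 9 8 8 13] arc12_inter[of 0 0 5 8 12 13]
      arc12_inter[of 0 2 5 2 2 3] arc12_inter[of 4 6 9 6 6 7] arc12_inter[of 8 10 13 10 10 11]
    by (simp_all add: net_arcs_def net_simps)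
  \<comment> \<open>Each pair is ordered so that the second arc starts after the first ends and
    stops before the first recurs.\<close>
  moreover have "net_arcs 0 \<inter> net_arcs 4 = {}" "net_arcs 0 \<inter> net_arcs 5 = {}"
    "net_arcs 1 \<inter> net_arcs 5 = {}" "net_arcs 3 \<inter> net_arcs 1 = {}" "net_arcs 3 \<inter> net_arcs 2 = {}"
    "net_arcs 4 \<inter> net_arcs 2 = {}" "net_arcs 3 \<inter> net_arcs 4 = {}" "net_arcs 3 \<inter> net_arcs 5 = {}"
    "net_arcs 4 \<inter> net_arcs 5 = {}"
    by (simp_all add: net_arcs_def net_simps arc12_disjoint)
  ultimately show ?thesis
    using assms unfolding net_simps
    by (elim insertE emptyE; simp add: net_def Int_commute)
qed

lemma ca_representation_net: "ca_representation net net_arcs"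
proof -
  note sym = pair_graph_adj_sym[OF pair_graph_net]
  have len: "net_left v < net_right v" "net_right v < net_left v + 12" if "v \<in> pverts net" for v
    using that by (auto simp: net_simps)
  have ends: "arc_endpoints (net_arcs v) =
      {clock (of_int (net_left v)), clock (of_int (net_right v))}"
    if "v \<in> pverts net" for v
    unfolding net_arcs_def using arc12_endpoints[OF len[OF that]] .
  have "net_left v mod 12 \<noteq> net_right v mod 12" if "v \<in> pverts net" for v
    using that by (auto simp: net_simps)
  then have card2: "card (arc_endpoints (net_arcs v)) = 2" if "v \<in> pverts net" for v
    using that by (simp add: ends clock_int_eq_iff)
  have arcs: "circle_arc (net_arcs v)" if "v \<in> pverts net" for v
    unfolding net_arcs_def using arc12_circle_arc[OF len[OF that]] .
  have "net_left u mod 12 \<noteq> net_left v mod 12 \<and> net_left u mod 12 \<noteq> net_right v mod 12 \<and>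
      net_right u mod 12 \<noteq> net_left v mod 12 \<and> net_right u mod 12 \<noteq> net_right v mod 12"
    if "u \<in> pverts net" "v \<in> pverts net" "u \<noteq> v" for u v
    using that unfolding net_simps(1) by (elim insertE emptyE; simp add: net_simps)
  then have disj: "arc_endpoints (net_arcs u) \<inter> arc_endpoints (net_arcs v) = {}"
    if "u \<in> pverts net" "v \<in> pverts net" "u \<noteq> v" for u v
    using that by (simp add: ends clock_int_eq_iff)
  have adj: "(u, v) \<in> parcs net \<longleftrightarrow> net_arcs u \<inter> net_arcs v \<noteq> {}"
    if "u \<in> pverts net" "v \<in> pverts net" "u \<noteq> v" for u v
    using net_adjacent_iff[of u v] net_adjacent_iff[of v u] sym[of u v] sym[of v u] that
    by (metis Int_commute nat_neq_iff)
  \<comment> \<open>Equal arcs at distinct vertices would have an endpoint set disjoint from itself,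
    hence empty instead of of size 2.\<close>
  have "inj_on net_arcs (pverts net)"
    using disj card2 by (metis (no_types, lifting) card.empty inf.idem inj_onI zero_neq_numeral)
  then show ?thesis
    using card2 arcs disj adj by (simp add: ca_representation_def)
qed

section \<open>Arbitrary representations of the net\<close>

text \<open>The arc of \<open>x\<close> meets \<open>\<rho> b\<close> at a point outside both other
  arcs; \<open>x\<close> will be the pendant vertex at \<open>b\<close>.\<close>

lemma net_middle_arc:
  assumes rep: "ca_representation net \<rho>" and "(x, b) \<in> parcs net"
    and "(x, a) \<notin> parcs net" "(x, c) \<notin> parcs net"
    and "x \<noteq> a" "x \<noteq> c" "a \<in> pverts net" "c \<in> pverts net"
  shows "\<not> \<rho> b \<subseteq> \<rho> a \<union> \<rho> c"
proof -
  note x = pair_graph_adj_verts[OF pair_graph_net assms(2)]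
  have "\<rho> x \<inter> \<rho> b \<noteq> {}" using ca_representation_adj[OF rep, of x b] x assms by simp
  moreover have "\<rho> x \<inter> \<rho> a = {}" using ca_representation_adj[OF rep, of x a] x assms by simp
  moreover have "\<rho> x \<inter> \<rho> c = {}" using ca_representation_adj[OF rep, of x c] x assms by simp
  ultimately show ?thesis by blast
qed

text \<open>Used twice: it refutes every candidate Helly representation and supplies the empty
  intersection demanded by uniformity.\<close>

lemma net_triangle_not_helly:
  assumes "ca_representation net \<rho>"
  shows "\<rho> 0 \<inter> \<rho> 1 \<inter> \<rho> 2 = {}"
proof (rule ccontr)
  assume "\<rho> 0 \<inter> \<rho> 1 \<inter> \<rho> 2 \<noteq> {}"
  then obtain p where p: "p \<in> \<rho> 0" "p \<in> \<rho> 1" "p \<in> \<rho> 2" by blast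
  have "connected (\<rho> v)" "\<rho> v \<subseteq> circle" if "v \<in> {0, 1, 2}" for v
    using ca_representation_arc[OF assms, of v] that by (auto simp: circle_arc_def net_simps)
  then have "\<rho> 0 \<subseteq> \<rho> 1 \<union> \<rho> 2 \<or> \<rho> 1 \<subseteq> \<rho> 0 \<union> \<rho> 2 \<or> \<rho> 2 \<subseteq> \<rho> 0 \<union> \<rho> 1"
    using three_connected_on_circle[OF _ _ _ _ _ _ p] by simp
  moreover have "\<not> \<rho> 0 \<subseteq> \<rho> 1 \<union> \<rho> 2"
    by (rule net_middle_arc[OF assms, of 3]) (simp_all add: net_def)
  moreover have "\<not> \<rho> 1 \<subseteq> \<rho> 0 \<union> \<rho> 2"
    by (rule net_middle_arc[OF assms, of 4]) (simp_all add: net_def)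
  moreover have "\<not> \<rho> 2 \<subseteq> \<rho> 0 \<union> \<rho> 1"
    by (rule net_middle_arc[OF assms, of 5]) (simp_all add: net_def)
  ultimately show False by blast
qed

lemma not_helly_net: "\<not> helly_ca_graph net"
proof
  assume "helly_ca_graph net"
  then obtain \<rho> where rep: "ca_representation net \<rho>"
    and helly: "\<forall>C. maximal_clique net C \<longrightarrow> (\<Inter>v\<in>C. \<rho> v) \<noteq> {}"
    by (auto simp: helly_ca_graph_def)
  obtain p where "p \<in> \<rho> 0" "p \<in> \<rho> 1" "p \<in> \<rho> 2"
    by (rule triangle_common_point[OF pair_graph_net helly, of 0 1 2]) (simp_all add: net_def)
  then show False using net_triangle_not_helly[OF rep] by blast
qed

lemma ov_triangle_net:
  assumes "ov_triangle net T"
  shows "T = {0, 1, 2}"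
proof -
  have T: "T \<subseteq> pverts net" "card T = 3" using assms by (auto simp: ov_triangle_def)
  have adj: "(u, v) \<in> parcs net" if "u \<in> T" "v \<in> T" "u \<noteq> v" for u v
    using assms that by (auto simp: ov_triangle_def intro: nbhd_matrix_ov_adj)
  obtain a b c where abc: "T = {a, b, c}" "a \<noteq> b" "b \<noteq> c" "a \<noteq> c"
    using T(2) by (auto simp: card_3_iff)
  then have "(a, b) \<in> parcs net" "(b, c) \<in> parcs net" "(a, c) \<in> parcs net"
    using adj by auto
  \<comment> \<open>Only the corners have two distinct neighbours.\<close>
  moreover have "u \<in> {0, 1, 2}" if "(u, v) \<in> parcs net" "(u, w) \<in> parcs net" "v \<noteq> w" for u v w
    using that by (auto simp: net_def)
  ultimately have "{a, b, c} \<subseteq> {0, 1, 2}"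
    using abc pair_graph_adj_sym[OF pair_graph_net] by (metis empty_subsetI insert_subset)
  then show ?thesis
    using T(2) abc(1) by (intro card_subset_eq) auto
qed

lemma uniform_net: "uniform_ca_graph net"
proof -
  have "non_helly_triangle (\<rho> ` T)"
    if "ov_triangle net T" "\<rho> \<in> normalized_representations net" for T \<rho>
  proof -
    have rep: "ca_representation net \<rho>"
      using that(2) by (simp add: normalized_representations_def)
    have T: "T = {0, 1, 2}" using ov_triangle_net[OF that(1)] .
    have sub: "T \<subseteq> pverts net" using T by (simp add: net_simps)
    have inj: "inj_on \<rho> T"
      using rep sub by (auto simp: ca_representation_def intro: inj_on_subset)
    have "card (\<rho> ` T) = 3" using card_image[OF inj] T by simp
    moreover have "\<forall>A \<in> \<rho> ` T. circle_arc A"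
      using rep sub by (auto simp: ca_representation_def)
    moreover have "\<rho> u \<inter> \<rho> v \<noteq> {}" if "u \<in> T" "v \<in> T" for u v
    proof (cases "u = v")
      \<comment> \<open>The pairs in \<open>non_helly_triangle\<close> may coincide, so each arc
        must be nonempty; having two endpoints ensures this.\<close>
      case True
      have "arc_endpoints {} = {}" by (simp add: arc_endpoints_def)
      then have "\<rho> u \<noteq> {}"
        using rep sub that by (force simp: ca_representation_def)
      then show ?thesis using True by simp
    next
      case False
      then have "(u, v) \<in> parcs net" using that T by (auto simp: net_def)
      then show ?thesis using ca_representation_adj[OF rep, of u v] False that sub by blast
    qed
    moreover have "\<Inter> (\<rho> ` T) = {}"
      using net_triangle_not_helly[OF rep] T by (simp add: Int_assoc)
    ultimately show ?thesis by (auto simp: non_helly_triangle_def)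
  qed
  then show ?thesis
    using pair_graph_net ca_representation_net by (auto simp: uniform_ca_graph_def ca_graph_def)
qed

theorem theorem18:
  shows "(\<forall>G :: 'a pair_pre_digraph.
            pair_graph G \<and> twin_free G \<and> \<not> has_universal_vertex G \<longrightarrow>
            helly_ca_graph G \<longrightarrow> uniform_ca_graph G) \<and>
         (\<exists>G :: nat pair_pre_digraph.
            pair_graph G \<and> twin_free G \<and> \<not> has_universal_vertex G \<and>
            uniform_ca_graph G \<and> \<not> helly_ca_graph G)"
  using helly_imp_uniform pair_graph_net twin_free_net no_universal_net uniform_net not_helly_net
  by blast

end
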